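(* Let $H$ be a finite hypergraph with positive functions $\delta_{V(H)}:V(H)\to(0,\infty)$ and $\delta_{E(H)}:E(H)\to(0,\infty)$. Suppose that for every unit $W_E\in\mathfrak{U}(H)$ there is a constant $c_E$ with $\delta_{V(H)}(v)=c_E$ for all $v\in W_E$. Then the complete spectrum of $Q_{(H,\delta_{V(H)},\delta_{E(H)})}$ is given as follows (eigenvalues counted with multiplicity). (1) For each unit $W_E\in\mathfrak{U}(H)$, $0$ is an eigenvalue of $Q_{(H,\delta_{V(H)},\delta_{E(H)})}$ with multiplicity $|W_E|-1$ (this being the contribution of the unit $W_E$ to the list), and $S_{W_E}$ is a subspace of the eigenspace of the eigenvalue $0$. (2) For each eigenvalue $\lambda$ of $\hat{Q}_H$ with eigenvector $y:\mathfrak{U}(H)\to\mathbb{C}$, $\lambda$ is also an eigenvalue of $Q_{(H,\delta_{V(H)},\delta_{E(H)})}$ with the blow up $y_{\mathfrak{R}_s}$ as an eigenvector.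
   Context: A (finite) hypergraph $H$ is a pair $(V(H),E(H))$, where $V(H)$ is a non-empty finite set and $E(H)$ is a collection of non-empty subsets of $V(H)$. For $v\in V(H)$ the star is $E_v(H)=\{e\in E(H):v\in e\}$. $\mathbb{C}^{X}$ is the space of functions $X\to\mathbb{C}$. Units: $\mathfrak{R}_s=\{(u,v)\in V(H)\times V(H):E_u(H)=E_v(H)\}$ is an equivalence relation; its classes are called units and $\mathfrak{U}(H)$ is the set of all units. A unit is written $W_E$, where $E\subseteq E(H)$ is its generating set: $W_E=\{v\in V(H):E_v(H)=E\}$. The general signless Laplacian $Q_{(H,\delta_{V(H)},\delta_{E(H)})}:\mathbb{C}^{V(H)}\to\mathbb{C}^{V(H)}$ is $$(Q_{(H,\delta_{V(H)},\delta_{E(H)})}x)(v)=\sum_{e\in E_v(H)}\frac{\delta_{E(H)}(e)}{\delta_{V(H)}(v)}\frac{1}{|e|^2}\sum_{u\in e}x(u).$$ When $\delta_{V(H)}$ equals a constant $c_E$ on each unit $W_E$, $\hat{Q}_H:\mathbb{C}^{\mathfrak{U}(H)}\to\mathbb{C}^{\mathfrak{U}(H)}$ is the contraction $$(\hat{Q}_Hy)(W_F)=\sum_{W_E\in\mathfrak{U}(H)}\Big(\sum_{e\in E\cap F}\frac{\delta_{E(H)}(e)}{c_F}\frac{1}{|e|^2}\Big)|W_E|\,y(W_E).$$ For $y:\mathfrak{U}(H)\to\mathbb{C}$, the blow up $y_{\mathfrak{R}_s}:V(H)\to\mathbb{C}$ is $y_{\mathfrak{R}_s}(v)=y(W)$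 where $W$ is the unit containing $v$. For $U\subseteq V(H)$, $S_U=\{x\in\mathbb{C}^{V(H)}: \{v: x(v)\neq 0\}\subseteq U,\ \sum_{v\in U}x(v)=0\}$. *)

theory Defs
  imports
    "HOL-Library.Function_Algebras"
    "Jordan_Normal_Form.Char_Poly"
begin

section \<open>Linear operators on spaces of complex-valued functions\<close>

definition cscale :: "complex \<Rightarrow> ('a \<Rightarrow> complex) \<Rightarrow> 'a \<Rightarrow> complex" where
  "cscale c x = (\<lambda>v. c * x v)"

global_interpretation cfun: vector_space cscale
  by unfold_locales (auto simp: cscale_def algebra_simps fun_eq_iff)

text \<open>The space of functions from a set \<open>X\<close> to the complex numbers: total functions
  with value 0 outside \<open>X\<close>, so that equality of functions is equality on \<open>X\<close>.\<close>

definition cspace :: "'a set \<Rightarrow> ('a \<Rightarrow> complex) set" where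
  "cspace X = {x. \<forall>v. v \<notin> X \<longrightarrow> x v = 0}"

text \<open>In the following, \<open>T\<close> is meant to restrict to a linear operator on \<open>cspace X\<close>.\<close>

definition op_eigenvector ::
  "'a set \<Rightarrow> (('a \<Rightarrow> complex) \<Rightarrow> 'a \<Rightarrow> complex) \<Rightarrow> ('a \<Rightarrow> complex) \<Rightarrow> complex \<Rightarrow> bool" where
  "op_eigenvector X T x \<mu> \<longleftrightarrow> x \<in> cspace X \<and> x \<noteq> 0 \<and> T x = cscale \<mu> x"

definition op_eigenvalue ::
  "'a set \<Rightarrow> (('a \<Rightarrow> complex) \<Rightarrow> 'a \<Rightarrow> complex) \<Rightarrow> complex \<Rightarrow> bool" where
  "op_eigenvalue X T \<mu> \<longleftrightarrow> (\<exists>x. op_eigenvector X T x \<mu>)"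

definition op_eigenspace ::
  "'a set \<Rightarrow> (('a \<Rightarrow> complex) \<Rightarrow> 'a \<Rightarrow> complex) \<Rightarrow> complex \<Rightarrow> ('a \<Rightarrow> complex) set" where
  "op_eigenspace X T \<mu> = {x \<in> cspace X. T x = cscale \<mu> x}"

text \<open>The matrix of \<open>T\<close> in the standard basis of \<open>cspace X\<close>, where \<open>xs\<close> enumerates \<open>X\<close>.\<close>

definition op_mat :: "'a list \<Rightarrow> (('a \<Rightarrow> complex) \<Rightarrow> 'a \<Rightarrow> complex) \<Rightarrow> complex mat" where
  "op_mat xs T = mat (length xs) (length xs)
     (\<lambda>(i, j). T (\<lambda>u. if u = xs ! j then 1 else 0) (xs ! i))"

lemma char_poly_op_mat_independent:
  assumes xs: "distinct xs" and ys: "distinct ys" and eq: "set xs = set ys"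
  shows "char_poly (op_mat xs T) = char_poly (op_mat ys T)"
proof (rule char_poly_similar)
  define n where "n = length xs"
  have ln: "length ys = n"
    using xs ys eq by (metis distinct_card n_def)
  define R where "R = mat n n (\<lambda>(i, j). if xs ! i = ys ! j then (1::complex) else 0)"
  define S where "S = mat n n (\<lambda>(i, j). if ys ! i = xs ! j then (1::complex) else 0)"
  have delta: "(\<Sum>k = 0..<n. (if a = zs ! k then (1::complex) else 0) * f (zs ! k)) = f a"
    if "a \<in> set zs" "distinct zs" "length zs = n" for a zs f
  proof -
    obtain k0 where k0: "k0 < n" "a = zs ! k0"
      using \<open>a \<in> set zs\<close> \<open>length zs = n\<close> by (metis in_set_conv_nth)
    have "(\<Sum>k = 0..<n. (if a = zs ! k then (1::complex) else 0) * f (zs ! k))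
        = (\<Sum>k = 0..<n. if k = k0 then f a else 0)"
      using k0 that by (intro sum.cong) (auto simp: nth_eq_iff_index_eq)
    then show ?thesis using k0 by simp
  qed
  have mem: "xs ! i \<in> set ys" "ys ! i \<in> set xs" if "i < n" for i
    using that eq ln n_def nth_mem by metis+
  have "R * S = 1\<^sub>m n"
  proof (rule eq_matI)
    fix i j assume "i < dim_row (1\<^sub>m n :: complex mat)" "j < dim_col (1\<^sub>m n :: complex mat)"
    then have ij: "i < n" "j < n" by auto
    then have "(R * S) $$ (i, j) = (\<Sum>k = 0..<n. (if xs ! i = ys ! k then 1 else 0)
        * (\<lambda>b. if b = xs ! j then 1 else 0) (ys ! k))"
      by (simp add: R_def S_def scalar_prod_def)
    also have "\<dots> = (if xs ! i = xs ! j then 1 else 0)"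
      by (rule delta[OF mem(1)[OF ij(1)] ys ln])
    finally show "(R * S) $$ (i, j) = 1\<^sub>m n $$ (i, j)"
      using ij xs n_def by (simp add: nth_eq_iff_index_eq)
  qed (auto simp: R_def S_def)
  moreover have "S * R = 1\<^sub>m n"
  proof (rule eq_matI)
    fix i j assume "i < dim_row (1\<^sub>m n :: complex mat)" "j < dim_col (1\<^sub>m n :: complex mat)"
    then have ij: "i < n" "j < n" by auto
    then have "(S * R) $$ (i, j) = (\<Sum>k = 0..<n. (if ys ! i = xs ! k then 1 else 0)
        * (\<lambda>b. if b = ys ! j then 1 else 0) (xs ! k))"
      by (simp add: R_def S_def scalar_prod_def)
    also have "\<dots> = (if ys ! i = ys ! j then 1 else 0)"
      by (rule delta[OF mem(2)[OF ij(1)] xs]) (simp add: n_def)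
    finally show "(S * R) $$ (i, j) = 1\<^sub>m n $$ (i, j)"
      using ij ys ln by (simp add: nth_eq_iff_index_eq)
  qed (auto simp: R_def S_def)
  moreover have "op_mat xs T = R * op_mat ys T * S"
  proof (rule eq_matI)
    fix i j assume "i < dim_row (R * op_mat ys T * S)" "j < dim_col (R * op_mat ys T * S)"
    then have ij: "i < n" "j < n" by (auto simp: R_def S_def)
    define g where "g b a = T (\<lambda>u. if u = b then 1 else 0) a" for a b
    have row: "(R * op_mat ys T) $$ (i, k) = g (ys ! k) (xs ! i)" if k: "k < n" for k
    proof -
      have "(R * op_mat ys T) $$ (i, k)
          = (\<Sum>l = 0..<n. (if xs ! i = ys ! l then 1 else 0) * g (ys ! k) (ys ! l))"
        using ij k ln by (simp add: R_def op_mat_def g_def scalar_prod_def)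
      also have "\<dots> = g (ys ! k) (xs ! i)"
        by (rule delta[OF mem(1)[OF ij(1)] ys ln])
      finally show ?thesis .
    qed
    have "(R * op_mat ys T * S) $$ (i, j)
        = (\<Sum>k = 0..<n. (R * op_mat ys T) $$ (i, k) * S $$ (k, j))"
      using ij ln by (simp add: R_def S_def op_mat_def scalar_prod_def)
    also have "\<dots> = (\<Sum>k = 0..<n. (if xs ! j = ys ! k then 1 else 0) * g (ys ! k) (xs ! i))"
      using ij row by (intro sum.cong) (auto simp: S_def)
    also have "\<dots> = g (xs ! j) (xs ! i)"
      by (rule delta[OF mem(1)[OF ij(2)] ys ln, of "\<lambda>b. g b (xs ! i)"])
    finally show "op_mat xs T $$ (i, j) = (R * op_mat ys T * S) $$ (i, j)"
      using ij n_def by (simp add: op_mat_def g_def)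
  qed (auto simp: R_def S_def op_mat_def n_def)
  ultimately show "similar_mat (op_mat xs T) (op_mat ys T)"
    by (intro similar_matI[of _ _ R S n])
      (auto simp: R_def S_def op_mat_def n_def ln[unfolded n_def])
qed

text \<open>The multiset of all eigenvalues, i.e. of the roots of the characteristic polynomial.
  For finite \<open>X\<close> an enumeration exists, and by the previous lemma its choice is irrelevant.\<close>

definition op_char_poly :: "'a set \<Rightarrow> (('a \<Rightarrow> complex) \<Rightarrow> 'a \<Rightarrow> complex) \<Rightarrow> complex poly" where
  "op_char_poly X T = char_poly (op_mat (SOME xs. distinct xs \<and> set xs = X) T)"

definition op_spectrum :: "'a set \<Rightarrow> (('a \<Rightarrow> complex) \<Rightarrow> 'a \<Rightarrow> complex) \<Rightarrow> complex multiset" where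
  "op_spectrum X T = proots (op_char_poly X T)"

lemma op_char_poly_eq:
  assumes "distinct xs" "set xs = X"
  shows "op_char_poly X T = char_poly (op_mat xs T)"
proof -
  have "distinct (SOME xs. distinct xs \<and> set xs = X) \<and> set (SOME xs. distinct xs \<and> set xs = X) = X"
    by (rule someI[of "\<lambda>xs. distinct xs \<and> set xs = X"]) (use assms in blast)
  then show ?thesis
    unfolding op_char_poly_def using assms by (intro char_poly_op_mat_independent) auto
qed


section \<open>Hypergraphs, units and the signless Laplacian\<close>

definition hypergraph :: "'v set \<Rightarrow> 'v set set \<Rightarrow> bool" where
  "hypergraph V E \<longleftrightarrow> finite V \<and> V \<noteq> {} \<and> (\<forall>e\<in>E. e \<noteq> {} \<and> e \<subseteq> V)"

definition star :: "'v set set \<Rightarrow> 'v \<Rightarrow> 'v set set" where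
  "star E v = {e \<in> E. v \<in> e}"

definition unit_rel :: "'v set \<Rightarrow> 'v set set \<Rightarrow> ('v \<times> 'v) set" where
  "unit_rel V E = {(u, v) \<in> V \<times> V. star E u = star E v}"

definition hg_units :: "'v set \<Rightarrow> 'v set set \<Rightarrow> 'v set set" where
  "hg_units V E = V // unit_rel V E"

definition unit_of :: "'v set \<Rightarrow> 'v set set \<Rightarrow> 'v set set \<Rightarrow> 'v set" where
  "unit_of V E F = {v \<in> V. star E v = F}"

text \<open>The generating set of a unit; it is unique because units are non-empty.\<close>

definition gen_set :: "'v set \<Rightarrow> 'v set set \<Rightarrow> 'v set \<Rightarrow> 'v set set" where
  "gen_set V E W = (THE F. F \<subseteq> E \<and> W = unit_of V E F)"

lemma gen_set_unit_of:
  assumes "F \<subseteq> E" "unit_of V E F \<noteq> {}"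
  shows "gen_set V E (unit_of V E F) = F"
  unfolding gen_set_def using assms by (intro the_equality) (auto simp: unit_of_def)

definition signless_laplacian ::
  "'v set \<Rightarrow> 'v set set \<Rightarrow> ('v \<Rightarrow> real) \<Rightarrow> ('v set \<Rightarrow> real) \<Rightarrow> ('v \<Rightarrow> complex) \<Rightarrow> 'v \<Rightarrow> complex" where
  "signless_laplacian V E \<delta>V \<delta>E x = (\<lambda>v. if v \<in> V then
     (\<Sum>e\<in>star E v. complex_of_real (\<delta>E e / \<delta>V v * (1 / (real (card e))\<^sup>2)) * (\<Sum>u\<in>e. x u))
     else 0)"

text \<open>Here \<open>c F\<close> is the value of the vertex weight on the unit with generating set \<open>F\<close>.\<close>

definition contraction ::
  "'v set \<Rightarrow> 'v set set \<Rightarrow> ('v set set \<Rightarrow> real) \<Rightarrow> ('v set \<Rightarrow> real)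
    \<Rightarrow> ('v set \<Rightarrow> complex) \<Rightarrow> 'v set \<Rightarrow> complex" where
  "contraction V E c \<delta>E y = (\<lambda>W. if W \<in> hg_units V E then
     (\<Sum>U\<in>hg_units V E.
        complex_of_real (\<Sum>e\<in>gen_set V E U \<inter> gen_set V E W.
            \<delta>E e / c (gen_set V E W) * (1 / (real (card e))\<^sup>2))
        * of_nat (card U) * y U)
     else 0)"

definition blow_up :: "'v set \<Rightarrow> 'v set set \<Rightarrow> ('v set \<Rightarrow> complex) \<Rightarrow> 'v \<Rightarrow> complex" where
  "blow_up V E y = (\<lambda>v. if v \<in> V then y (unit_rel V E `` {v}) else 0)"

definition zero_sum_space :: "'v set \<Rightarrow> 'v set \<Rightarrow> ('v \<Rightarrow> complex) set" where
  "zero_sum_space V U = {x \<in> cspace V. {v. x v \<noteq> 0} \<subseteq> U \<and> (\<Sum>v\<in>U. x v) = 0}"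

end

theory Submission
  imports Defs
begin

text \<open>The signless Laplacian \<open>Q\<close> first sums a function over the edges. Every edge is a disjoint
  union of units, so these sums depend only on the sums of the function over the units; and as the
  vertex weight is constant on units, the result is again constant on units. Thus \<open>Q\<close> is a composite
  \<open>blow_up \<circ> T\<close>, where \<open>T\<close> maps functions on vertices to functions on units, and a change of the
  order of summation shows that the contraction is \<open>T \<circ> blow_up\<close>
  (\<open>signless_laplacian_factors\<close>, \<open>contraction_factors\<close>).

  Two composites of the same maps in opposite orders have, up to powers of \<open>x\<close>, the same
  characteristic polynomial (\<open>op_spectrum_comp_commute\<close>). So the spectrum of \<open>Q\<close> is that of the
  contraction together with \<open>card V - card (hg_units V E)\<close> zeros, and this number is
  the sum of \<open>card W - 1\<close> over all units \<open>W\<close>.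

  For the geometric multiplicities, every function on the vertices is uniquely the sum of a function
  with zero sum on each unit and a blow up. The map \<open>T\<close> vanishes on the former, and \<open>Q\<close> acts on the
  blow ups, which are in bijection with the functions on units, as the contraction does. Hence every
  eigenspace of \<open>Q\<close> is the blow up of the corresponding eigenspace of the contraction, with the
  unit-sum-free functions added for the eigenvalue 0 (\<open>op_eigenspace_decomposition\<close>).\<close>

section \<open>Characteristic polynomials of matrix products\<close>

lemma char_poly_four_block_upper_right_zero:
  fixes A :: "'a :: idom mat"
  assumes A: "A \<in> carrier_mat n n" and C: "C \<in> carrier_mat m n" and D: "D \<in> carrier_mat m m"
  shows "char_poly (four_block_mat A (0\<^sub>m n m) C D) = char_poly A * char_poly D"
proof -
  have "char_poly_matrix (four_block_mat A (0\<^sub>m n m) C D)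
      = four_block_mat (char_poly_matrix A) (0\<^sub>m n m) (map_mat (\<lambda>a. [:- a:]) C) (char_poly_matrix D)"
    using assms by (intro eq_matI) (auto simp: char_poly_matrix_def)
  then show ?thesis
    using det_four_block_mat_upper_right_zero[of "char_poly_matrix A" n "0\<^sub>m n m" m
        "map_mat (\<lambda>a. [:- a:]) C" "char_poly_matrix D"] assms
    by (simp add: char_poly_def)
qed

lemma char_poly_zero_mat: "char_poly (0\<^sub>m n n :: 'a :: idom mat) = monom 1 n"
proof -
  have "upper_triangular (0\<^sub>m n n :: 'a mat)" by (auto simp: upper_triangular_def)
  moreover have "diag_mat (0\<^sub>m n n :: 'a mat) = replicate n 0"
    by (auto simp: diag_mat_def intro: nth_equalityI)
  ultimately have "char_poly (0\<^sub>m n n :: 'a mat) = [:0, 1:] ^ n"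
    by (subst char_poly_upper_triangular[of _ n]) (auto simp: prod_list_replicate)
  then show ?thesis by (simp add: monom_altdef)
qed

text \<open>The block matrices with rows \<open>(A * B, 0), (B, 0)\<close> and \<open>(0, 0), (B, B * A)\<close> are conjugate
  under the block matrix with rows \<open>(1, A), (0, 1)\<close>; being block triangular, they have the two
  sides of the equation as characteristic polynomials.\<close>

lemma char_poly_mult_commute:
  fixes A B :: "'a :: idom mat"
  assumes A: "A \<in> carrier_mat n m" and B: "B \<in> carrier_mat m n"
  shows "monom 1 m * char_poly (A * B) = monom 1 n * char_poly (B * A)"
proof -
  define M where "M = four_block_mat (A * B) (0\<^sub>m n m) B (0\<^sub>m m m)"
  define N where "N = four_block_mat (0\<^sub>m n n) (0\<^sub>m n m) B (B * A)"
  define P where "P = four_block_mat (1\<^sub>m n) A (0\<^sub>m m n) (1\<^sub>m m)"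
  define R where "R = four_block_mat (1\<^sub>m n) (- A) (0\<^sub>m m n) (1\<^sub>m m)"
  have P: "P \<in> carrier_mat (n + m) (n + m)" and R: "R \<in> carrier_mat (n + m) (n + m)"
    and M: "M \<in> carrier_mat (n + m) (n + m)" and N: "N \<in> carrier_mat (n + m) (n + m)"
    using A B by (auto simp: P_def R_def M_def N_def)
  have one: "four_block_mat (1\<^sub>m n) (0\<^sub>m n m) (0\<^sub>m m n) (1\<^sub>m m) = (1\<^sub>m (n + m) :: 'a mat)"
    by (intro eq_matI) auto
  have neg0: "- 0\<^sub>m m m = (0\<^sub>m m m :: 'a mat)"
    by (intro eq_matI) auto
  have PR: "P * R = 1\<^sub>m (n + m)"
    unfolding P_def R_def using A
    by (subst mult_four_block_mat[where ?nr1.0 = n and ?nr2.0 = m and ?n1.0 = n and ?n2.0 = m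
          and ?nc1.0 = n and ?nc2.0 = m])
      (auto simp: one neg0 uminus_l_inv_mat)
  have RP: "R * P = 1\<^sub>m (n + m)"
    unfolding P_def R_def using A
    by (subst mult_four_block_mat[where ?nr1.0 = n and ?nr2.0 = m and ?n1.0 = n and ?n2.0 = m
          and ?nc1.0 = n and ?nc2.0 = m])
      (auto simp: one neg0 add_uminus_minus_mat[of A n m])
  have "P * N = M * P"
  proof -
    have "P * N = four_block_mat (A * B) (A * (B * A)) B (B * A)"
      unfolding P_def N_def using A B
      by (subst mult_four_block_mat[where ?nr1.0 = n and ?nr2.0 = m and ?n1.0 = n and ?n2.0 = m
            and ?nc1.0 = n and ?nc2.0 = m]) auto
    moreover have "M * P = four_block_mat (A * B) (A * B * A) B (B * A)"
      unfolding P_def M_def using A B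
      by (subst mult_four_block_mat[where ?nr1.0 = n and ?nr2.0 = m and ?n1.0 = n and ?n2.0 = m
            and ?nc1.0 = n and ?nc2.0 = m]) auto
    ultimately show ?thesis using A B by simp
  qed
  then have "M = P * N * R"
    using PR M P R by (metis assoc_mult_mat right_mult_one_mat)
  then have "similar_mat M N"
    using P R M N PR RP by (intro similar_matI[of _ _ P R "n + m"]) auto
  then have "char_poly M = char_poly N"
    by (rule char_poly_similar)
  moreover have "char_poly M = char_poly (A * B) * monom 1 m"
    unfolding M_def using A B
    by (subst char_poly_four_block_upper_right_zero) (auto simp: char_poly_zero_mat)
  moreover have "char_poly N = monom 1 n * char_poly (B * A)"
    unfolding N_def using A B
    by (subst char_poly_four_block_upper_right_zero) (auto simp: char_poly_zero_mat)
  ultimately show ?thesis by (simp add: mult.commute)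
qed

section \<open>Dimensions of spaces of functions\<close>

text \<open>Only the summands are finite-dimensional: the functions on an infinite type, which contain
  all spaces below, form an infinite-dimensional space.\<close>

lemma (in vector_space) dim_direct_sum:
  assumes S: "subspace S" "S \<subseteq> span F" "finite F"
    and T: "subspace T" "T \<subseteq> span G" "finite G"
    and ST: "S \<inter> T = {0}"
  shows "dim {x + y | x y. x \<in> S \<and> y \<in> T} = dim S + dim T"
proof -
  obtain B where B: "B \<subseteq> S" "independent B" "S \<subseteq> span B" "card B = dim S"
    by (rule basis_exists)
  obtain C where C: "C \<subseteq> T" "independent C" "T \<subseteq> span C" "card C = dim T"
    by (rule basis_exists)
  have fin: "finite B" "finite C"
    using independent_span_bound[OF S(3) B(2)] independent_span_bound[OF T(3) C(2)]
      B(1) C(1) S(2) T(2) by auto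
  have sp: "span B = S" "span C = T"
    using span_subspace[OF B(1,3) S(1)] span_subspace[OF C(1,3) T(1)] by simp_all
  have disj: "B \<inter> C = {}"
  proof -
    have "B \<inter> C \<subseteq> {0}" using B(1) C(1) ST by blast
    moreover have "0 \<notin> B" using B(2) dependent_zero by blast
    ultimately show ?thesis by blast
  qed
  have ind: "independent (B \<union> C)"
  proof (rule independent_if_scalars_zero)
    fix f v assume 0: "(\<Sum>w\<in>B \<union> C. f w *s w) = 0" and v: "v \<in> B \<union> C"
    let ?b = "\<Sum>w\<in>B. f w *s w" and ?c = "\<Sum>w\<in>C. f w *s w"
    have bc: "?b + ?c = 0"
      using 0 fin disj by (simp add: sum.union_disjoint)
    have "?b \<in> S" "?c \<in> T"
      using sp by (auto intro!: span_sum span_scale intro: span_base)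
    moreover have "?b = - ?c"
      using bc by (simp add: eq_neg_iff_add_eq_0)
    ultimately have "?b \<in> S \<inter> T"
      using T(1) subspace_neg by auto
    then have "?b = 0" "?c = 0"
      using ST bc by auto
    then show "f v = 0"
      using v independentD[OF B(2) fin(1) order_refl, of f v]
        independentD[OF C(2) fin(2) order_refl, of f v] by auto
  qed (use fin in auto)
  have "span (B \<union> C) = {x + y | x y. x \<in> S \<and> y \<in> T}"
    by (simp add: span_Un sp)
  then have "dim {x + y | x y. x \<in> S \<and> y \<in> T} = card (B \<union> C)"
    using dim_span_eq_card_independent[OF ind] by simp
  then show ?thesis
    using card_Un_disjoint[OF fin disj] B(4) C(4) by simp
qed

lemma (in vector_space_pair) dim_inj_image:
  assumes f: "Vector_Spaces.linear s1 s2 f" and S: "vs1.subspace S" and inj: "inj_on f S"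
  shows "vs2.dim (f ` S) = vs1.dim S"
proof -
  obtain B where B: "B \<subseteq> S" "vs1.independent B" "S \<subseteq> vs1.span B" "card B = vs1.dim S"
    by (rule vs1.basis_exists)
  have sp: "vs1.span B = S"
    using B S by (intro vs1.span_subspace)
  have "vs2.independent (f ` B)"
    using B(2) inj sp linear_independent_injective_image[OF f] by simp
  moreover have "vs2.span (f ` B) = f ` S"
    using linear_span_image[OF f] sp by simp
  ultimately have "vs2.dim (f ` S) = card (f ` B)"
    using vs2.dim_span_eq_card_independent by metis
  then show ?thesis
    using B(1,4) inj by (simp add: card_image inj_on_subset)
qed

interpretation cfun2: vector_space_pair cscale cscale ..

abbreviation point_fun :: "'a \<Rightarrow> 'a \<Rightarrow> complex" where
  "point_fun w \<equiv> (\<lambda>u. if u = w then 1 else 0)"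

lemma sum_fun_apply: "(\<Sum>a\<in>A. f a) x = (\<Sum>a\<in>A. f a x)"
  by (induction A rule: infinite_finite_induct) auto

lemma cscale_apply [simp]: "cscale c x v = c * x v"
  by (simp add: cscale_def)

lemma subspace_cspace: "cfun.subspace (cspace X)"
  by (auto simp: cfun.subspace_def cspace_def)

lemma cspace_expansion:
  assumes "finite X" "x \<in> cspace X"
  shows "x = (\<Sum>w\<in>X. cscale (x w) (point_fun w))"
  using assms by (auto simp: fun_eq_iff sum_fun_apply cspace_def if_distrib cong: if_cong)

lemma span_point_fun: "finite X \<Longrightarrow> cfun.span (point_fun ` X) = cspace X"
proof (rule antisym)
  show "cfun.span (point_fun ` X) \<subseteq> cspace X"
    by (rule cfun.span_minimal[OF _ subspace_cspace]) (auto simp: cspace_def)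
  show "cspace X \<subseteq> cfun.span (point_fun ` X)" if "finite X"
  proof
    fix x assume "x \<in> cspace X"
    then have "x = (\<Sum>w\<in>X. cscale (x w) (point_fun w))"
      using that by (rule cspace_expansion[rotated])
    also have "\<dots> \<in> cfun.span (point_fun ` X)"
      by (intro cfun.span_sum cfun.span_scale cfun.span_base imageI)
    finally show "x \<in> cfun.span (point_fun ` X)" .
  qed
qed

lemma inj_point_fun: "inj point_fun"
  by (rule injI) (metis zero_neq_one)

lemma dim_cspace:
  assumes "finite X"
  shows "cfun.dim (cspace X) = card X"
proof -
  have "cfun.independent (point_fun ` X)"
  proof (rule cfun.independent_if_scalars_zero)
    fix f x assume 0: "(\<Sum>b\<in>point_fun ` X. cscale (f b) b) = 0" and "x \<in> point_fun ` X"
    then obtain w where w: "w \<in> X" "x = point_fun w" by blast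
    have "(\<Sum>u\<in>X. f (point_fun u) * point_fun u w) = (\<Sum>b\<in>point_fun ` X. cscale (f b) b) w"
      by (simp add: sum.reindex inj_on_subset[OF inj_point_fun] sum_fun_apply del: if_distrib)
    also have "\<dots> = 0" by (simp only: 0 zero_fun_apply)
    finally show "f x = 0"
      using w assms by (simp add: if_distrib cong: if_cong)
  qed (use assms in simp)
  then have "cfun.dim (cspace X) = card (point_fun ` X)"
    using span_point_fun[OF assms] cfun.dim_span_eq_card_independent by metis
  then show ?thesis
    by (simp add: card_image inj_on_subset[OF inj_point_fun])
qed

lemma subspace_op_eigenspace:
  assumes "Vector_Spaces.linear cscale cscale (T :: ('a \<Rightarrow> complex) \<Rightarrow> 'a \<Rightarrow> complex)"
  shows "cfun.subspace (op_eigenspace X T \<mu>)"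
  using cfun.subspace_0[OF subspace_cspace] cfun.subspace_add[OF subspace_cspace]
    cfun.subspace_scale[OF subspace_cspace] cfun2.linear_0[OF assms]
  by (auto simp: cfun.subspace_def op_eigenspace_def cfun2.linear_add[OF assms]
      cfun2.linear_scale[OF assms] cfun.scale_right_distrib mult.commute)

lemma dim_direct_sum_cspace:
  assumes "finite X" "cfun.subspace S" "cfun.subspace T" "S \<subseteq> cspace X" "T \<subseteq> cspace X"
    and "S \<inter> T = {0}"
  shows "cfun.dim {x + y | x y. x \<in> S \<and> y \<in> T} = cfun.dim S + cfun.dim T"
  using assms by (intro cfun.dim_direct_sum[of _ "point_fun ` X" _ "point_fun ` X"])
    (auto simp: span_point_fun)

section \<open>Spectra of composed operators\<close>

text \<open>The spaces may differ, so that the two factors of an operator have (rectangular) matrices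
  whose product is the matrix of the operator.\<close>

definition op_mat_between :: "'b list \<Rightarrow> 'a list \<Rightarrow> (('a \<Rightarrow> complex) \<Rightarrow> 'b \<Rightarrow> complex) \<Rightarrow> complex mat" where
  "op_mat_between ys xs T = mat (length ys) (length xs) (\<lambda>(i, j). T (point_fun (xs ! j)) (ys ! i))"

lemma op_mat_between_comp:
  assumes S: "Vector_Spaces.linear cscale cscale S" and T: "\<And>x. T x \<in> cspace (set ys)"
    and ys: "distinct ys"
  shows "op_mat_between zs xs (S \<circ> T) = op_mat_between zs ys S * op_mat_between ys xs T"
proof (rule eq_matI)
  fix i j
  assume "i < dim_row (op_mat_between zs ys S * op_mat_between ys xs T)"
    "j < dim_col (op_mat_between zs ys S * op_mat_between ys xs T)"
  then have i: "i < length zs" and j: "j < length xs"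
    by (auto simp: op_mat_between_def)
  define t where "t = T (point_fun (xs ! j))"
  have "S t = S (\<Sum>w\<in>set ys. cscale (t w) (point_fun w))"
    using cspace_expansion[of "set ys" t] T by (simp add: t_def)
  also have "\<dots> = (\<Sum>w\<in>set ys. cscale (t w) (S (point_fun w)))"
    by (simp add: cfun2.linear_sum[OF S] cfun2.linear_scale[OF S])
  finally have "S t (zs ! i) = (\<Sum>w\<in>set ys. t w * S (point_fun w) (zs ! i))"
    by (simp add: sum_fun_apply)
  also have "\<dots> = (\<Sum>k = 0..<length ys. t (ys ! k) * S (point_fun (ys ! k)) (zs ! i))"
    by (rule sum.reindex_bij_betw[symmetric]) (use bij_betw_nth[OF ys] in \<open>simp add: atLeast0LessThan\<close>)
  finally show "op_mat_between zs xs (S \<circ> T) $$ (i, j) = (op_mat_between zs ys S * op_mat_between ys xs T) $$ (i, j)"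
    using i j by (simp add: op_mat_between_def scalar_prod_def t_def mult.commute)
qed (auto simp: op_mat_between_def)

lemma op_char_poly_nonzero: "finite X \<Longrightarrow> op_char_poly X T \<noteq> 0"
proof -
  assume "finite X"
  then obtain xs where "distinct xs" "set xs = X"
    using finite_distinct_list by blast
  then have eq: "op_char_poly X T = char_poly (op_mat xs T)"
    by (rule op_char_poly_eq)
  have "coeff (char_poly (op_mat xs T)) (length xs) = 1"
    using degree_monic_char_poly[of "op_mat xs T" "length xs"] by (simp add: op_mat_def)
  then show ?thesis
    unfolding eq by (metis coeff_0 zero_neq_one)
qed

lemma replicate_mset_add: "replicate_mset (m + n) a = replicate_mset m a + replicate_mset n a"
  by (simp add: multiset_eq_iff)

lemma proots_monom_one: "proots (monom 1 n :: complex poly) = replicate_mset n 0"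
  by (simp add: monom_altdef proots_power multiset_eq_iff)

text \<open>The multiset form of \<open>x ^ card Y * \<chi>(S T) = x ^ card X * \<chi>(T S)\<close>: composing two maps
  in either order gives the same nonzero eigenvalues, and the dimensions account for the zeros.\<close>

lemma op_spectrum_comp_commute:
  assumes fin: "finite X" "finite Y"
    and S: "Vector_Spaces.linear cscale cscale S" "\<And>y. S y \<in> cspace X"
    and T: "Vector_Spaces.linear cscale cscale T" "\<And>x. T x \<in> cspace Y"
  shows "replicate_mset (card Y) 0 + op_spectrum X (S \<circ> T)
       = replicate_mset (card X) 0 + op_spectrum Y (T \<circ> S)"
proof -
  obtain xs where xs: "distinct xs" "set xs = X" using fin finite_distinct_list by blast
  obtain ys where ys: "distinct ys" "set ys = Y" using fin finite_distinct_list by blast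
  have X: "op_char_poly X (S \<circ> T) = char_poly (op_mat_between xs ys S * op_mat_between ys xs T)"
    using op_mat_between_comp[of S T ys xs xs] S T xs ys
    by (simp add: op_char_poly_eq[OF xs] op_mat_def op_mat_between_def)
  have Y: "op_char_poly Y (T \<circ> S) = char_poly (op_mat_between ys xs T * op_mat_between xs ys S)"
    using op_mat_between_comp[of T S xs ys ys] S T xs ys
    by (simp add: op_char_poly_eq[OF ys] op_mat_def op_mat_between_def)
  have "monom 1 (length ys) * op_char_poly X (S \<circ> T) = monom 1 (length xs) * op_char_poly Y (T \<circ> S)"
    unfolding X Y by (rule char_poly_mult_commute) (auto simp: op_mat_between_def)
  then have "proots (monom 1 (length ys) * op_char_poly X (S \<circ> T))
      = proots (monom 1 (length xs) * op_char_poly Y (T \<circ> S))"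
    by simp
  moreover have "length xs = card X" "length ys = card Y"
    using xs ys distinct_card by fastforce+
  ultimately show ?thesis
    using fin by (simp add: proots_mult op_char_poly_nonzero proots_monom_one op_spectrum_def monom_eq_0_iff)
qed

section \<open>Units of a hypergraph\<close>

locale finite_hypergraph =
  fixes V :: "'v set" and E :: "'v set set"
  assumes hypergraph: "hypergraph V E"
begin

abbreviation units :: "'v set set" where
  "units \<equiv> hg_units V E"

lemma finite_V: "finite V"
  using hypergraph by (simp add: hypergraph_def)

lemma edge_subset: "e \<in> E \<Longrightarrow> e \<subseteq> V"
  using hypergraph by (simp add: hypergraph_def)

lemma finite_E: "finite E"
  using edge_subset finite_V by (meson PowI finite_Pow_iff finite_subset subsetI)

lemma unit_class: "v \<in> V \<Longrightarrow> unit_rel V E `` {v} = unit_of V E (star E v)"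
  by (auto simp: unit_rel_def unit_of_def)

lemma units_eq: "units = (\<lambda>v. unit_of V E (star E v)) ` V"
  unfolding hg_units_def quotient_def using unit_class by auto

lemma finite_units: "finite units"
  by (simp add: units_eq finite_V)

lemma unit_mem:
  assumes "W \<in> units" "v \<in> W"
  shows "v \<in> V" "unit_of V E (star E v) = W" "unit_rel V E `` {v} = W" "gen_set V E W = star E v"
proof -
  show v: "v \<in> V" and W: "unit_of V E (star E v) = W"
    using assms by (auto simp: units_eq unit_of_def)
  then show "unit_rel V E `` {v} = W"
    using unit_class by simp
  show "gen_set V E W = star E v"
    using gen_set_unit_of[of "star E v" E V] W assms(2) by (auto simp: star_def)
qed

lemma unit_nonempty: "W \<in> units \<Longrightarrow> W \<noteq> {}"
  by (auto simp: units_eq unit_of_def)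

lemma unit_subset: "W \<in> units \<Longrightarrow> W \<subseteq> V"
  using unit_mem(1) by blast

lemma finite_unit: "W \<in> units \<Longrightarrow> finite W"
  using unit_subset finite_V finite_subset by blast

lemma units_disjoint: "W \<in> units \<Longrightarrow> U \<in> units \<Longrightarrow> W \<noteq> U \<Longrightarrow> W \<inter> U = {}"
  using unit_mem(3) by blast

lemma unit_containing: "v \<in> V \<Longrightarrow> \<exists>W\<in>units. v \<in> W"
  by (auto simp: units_eq unit_of_def)

lemma gen_set_subset: "W \<in> units \<Longrightarrow> gen_set V E W \<subseteq> E"
proof -
  assume W: "W \<in> units"
  then obtain v where "v \<in> W" using unit_nonempty by blast
  then show ?thesis using unit_mem(4)[OF W] by (auto simp: star_def)
qed

lemma sum_Union_units:
  fixes x :: "'v \<Rightarrow> 'b :: comm_monoid_add"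
  assumes "\<U> \<subseteq> units"
  shows "(\<Sum>v\<in>\<Union>\<U>. x v) = (\<Sum>U\<in>\<U>. \<Sum>u\<in>U. x u)"
proof (subst sum.Union_disjoint)
  show "\<forall>A\<in>\<U>. finite A"
    using assms finite_unit by blast
  show "\<forall>A\<in>\<U>. \<forall>B\<in>\<U>. A \<noteq> B \<longrightarrow> A \<inter> B = {}"
    using assms units_disjoint by blast
qed simp

lemma edge_Union_units:
  assumes "e \<in> E"
  shows "\<Union>{U \<in> units. e \<in> gen_set V E U} = e"
proof (rule Set.set_eqI)
  fix v
  show "v \<in> \<Union>{U \<in> units. e \<in> gen_set V E U} \<longleftrightarrow> v \<in> e"
  proof
    assume "v \<in> \<Union>{U \<in> units. e \<in> gen_set V E U}"
    then obtain U where "U \<in> units" "e \<in> gen_set V E U" "v \<in> U" by blast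
    then show "v \<in> e" using unit_mem(4) by (simp add: star_def)
  next
    assume v: "v \<in> e"
    then obtain U where U: "U \<in> units" "v \<in> U"
      using edge_subset[OF assms] unit_containing by blast
    then have "e \<in> gen_set V E U"
      using v assms unit_mem(4) by (simp add: star_def)
    then show "v \<in> \<Union>{U \<in> units. e \<in> gen_set V E U}"
      using U by blast
  qed
qed

text \<open>A unit meets an edge only if it lies inside it, because its vertices lie in the same
  edges. Hence a function enters the Laplacian only through its sums over units.\<close>

lemma sum_edge:
  fixes x :: "'v \<Rightarrow> 'b :: comm_monoid_add"
  assumes "e \<in> E"
  shows "(\<Sum>u\<in>e. x u) = (\<Sum>U\<in>units. if e \<in> gen_set V E U then \<Sum>u\<in>U. x u else 0)"
proof -
  have "(\<Sum>u\<in>e. x u) = (\<Sum>U | U \<in> units \<and> e \<in> gen_set V E U. \<Sum>u\<in>U. x u)"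
    using sum_Union_units[of "{U \<in> units. e \<in> gen_set V E U}" x] edge_Union_units[OF assms] by auto
  then show ?thesis
    by (simp add: sum.inter_filter finite_units)
qed

lemma Union_units: "\<Union>units = V"
  using unit_subset unit_containing by blast

lemma sum_card_units: "(\<Sum>W\<in>units. card W) = card V"
  using sum_Union_units[of units "\<lambda>_. 1 :: nat"] Union_units by simp

lemma sum_card_units_minus_one: "(\<Sum>W\<in>units. card W - 1) + card units = card V"
proof -
  have "(\<Sum>W\<in>units. card W - 1) + card units = (\<Sum>W\<in>units. card W - 1 + 1)"
    by (simp add: sum.distrib del: One_nat_def)
  also have "\<dots> = (\<Sum>W\<in>units. card W)"
    using unit_nonempty finite_unit by (intro sum.cong) (auto simp: Suc_leI card_gt_0_iff)
  finally show ?thesis using sum_card_units by simp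
qed

section \<open>Functions constant on units and functions with zero sum on units\<close>

lemma linear_blow_up: "Vector_Spaces.linear cscale cscale (blow_up V E)"
  by unfold_locales (auto simp: blow_up_def fun_eq_iff)

lemma blow_up_cspace: "blow_up V E y \<in> cspace V"
  by (simp add: blow_up_def cspace_def)

lemma blow_up_on_unit: "W \<in> units \<Longrightarrow> v \<in> W \<Longrightarrow> blow_up V E y v = y W"
  using unit_mem by (simp add: blow_up_def)

lemma sum_blow_up: "W \<in> units \<Longrightarrow> (\<Sum>v\<in>W. blow_up V E y v) = of_nat (card W) * y W"
  by (simp add: blow_up_on_unit)

lemma inj_on_blow_up: "inj_on (blow_up V E) (cspace units)"
proof (rule inj_onI)
  fix y z assume yz: "y \<in> cspace units" "z \<in> cspace units" "blow_up V E y = blow_up V E z"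
  show "y = z"
  proof
    fix W
    show "y W = z W"
    proof (cases "W \<in> units")
      case True
      then obtain v where "v \<in> W" using unit_nonempty by blast
      then show ?thesis using yz(3) blow_up_on_unit[OF True] by metis
    qed (use yz in \<open>auto simp: cspace_def\<close>)
  qed
qed

definition unit_sum_free :: "('v \<Rightarrow> complex) set" where
  "unit_sum_free = {x \<in> cspace V. \<forall>W\<in>units. (\<Sum>v\<in>W. x v) = 0}"

lemma subspace_unit_sum_free: "cfun.subspace unit_sum_free"
  by (auto simp: cfun.subspace_def unit_sum_free_def cspace_def sum.distrib simp flip: sum_distrib_left)

lemma blow_up_sum_free_trivial:
  assumes "y \<in> cspace units" "blow_up V E y \<in> unit_sum_free"
  shows "y = 0"
proof
  fix W
  show "y W = 0 W"
  proof (cases "W \<in> units")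
    case True
    then have "of_nat (card W) * y W = 0"
      using assms(2) sum_blow_up by (simp add: unit_sum_free_def)
    then show ?thesis
      using True unit_nonempty finite_unit by simp
  qed (use assms in \<open>auto simp: cspace_def\<close>)
qed

text \<open>Splitting off the mean of \<open>x\<close> over each unit leaves a function with zero unit sums.\<close>

lemma unit_mean_decomposition:
  assumes "x \<in> cspace V"
  obtains p y where "p \<in> unit_sum_free" "y \<in> cspace units" "x = p + blow_up V E y"
proof
  define y where "y W = (if W \<in> units then (\<Sum>v\<in>W. x v) / of_nat (card W) else 0)" for W
  show "y \<in> cspace units"
    by (simp add: cspace_def y_def)
  show "x = (x - blow_up V E y) + blow_up V E y"
    by simp
  have "x - blow_up V E y \<in> cspace V"
    using assms blow_up_cspace by (simp add: cfun.subspace_diff subspace_cspace)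
  moreover have "(\<Sum>v\<in>W. (x - blow_up V E y) v) = 0" if "W \<in> units" for W
    using that unit_nonempty finite_unit
    by (simp add: sum_subtractf sum_blow_up) (simp add: y_def)
  ultimately show "x - blow_up V E y \<in> unit_sum_free"
    by (simp add: unit_sum_free_def)
qed

text \<open>The sum is direct because only 0 is a blow up with zero unit sums, and blowing up preserves
  the dimension because it is injective.\<close>

lemma dim_sum_free_plus_blow_up:
  assumes "cfun.subspace S" "S \<subseteq> unit_sum_free" "cfun.subspace Y" "Y \<subseteq> cspace units"
  shows "cfun.dim {x + y | x y. x \<in> S \<and> y \<in> blow_up V E ` Y} = cfun.dim S + cfun.dim Y"
proof -
  have sub: "cfun.subspace (blow_up V E ` Y)"
    by (rule cfun2.linear_subspace_image[OF linear_blow_up assms(3)])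
  have "S \<inter> blow_up V E ` Y = {0}"
  proof
    show "S \<inter> blow_up V E ` Y \<subseteq> {0}"
      using assms blow_up_sum_free_trivial cfun2.linear_0[OF linear_blow_up] by blast
    show "{0} \<subseteq> S \<inter> blow_up V E ` Y"
      using cfun.subspace_0 assms(1) sub by blast
  qed
  then have "cfun.dim {x + y | x y. x \<in> S \<and> y \<in> blow_up V E ` Y}
      = cfun.dim S + cfun.dim (blow_up V E ` Y)"
    using assms sub blow_up_cspace
    by (intro dim_direct_sum_cspace[OF finite_V]) (auto simp: unit_sum_free_def)
  moreover have "cfun.dim (blow_up V E ` Y) = cfun.dim Y"
    using assms inj_on_blow_up
    by (intro cfun2.dim_inj_image linear_blow_up) (auto intro: inj_on_subset)
  ultimately show ?thesis by simp
qed

text \<open>By the mean decomposition the unit-sum-free functions are a complement of the blow ups,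
  whose space has one dimension for each unit.\<close>

lemma dim_unit_sum_free: "cfun.dim unit_sum_free = (\<Sum>W\<in>units. card W - 1)"
proof -
  have "cspace V = {x + y | x y. x \<in> unit_sum_free \<and> y \<in> blow_up V E ` cspace units}"
  proof (intro equalityI subsetI)
    fix x assume "x \<in> cspace V"
    then show "x \<in> {x + y | x y. x \<in> unit_sum_free \<and> y \<in> blow_up V E ` cspace units}"
      by (rule unit_mean_decomposition) blast
  next
    fix z assume "z \<in> {x + y | x y. x \<in> unit_sum_free \<and> y \<in> blow_up V E ` cspace units}"
    then show "z \<in> cspace V"
      using blow_up_cspace cfun.subspace_add[OF subspace_cspace] by (auto simp: unit_sum_free_def)
  qed
  then have "cfun.dim (cspace V) = cfun.dim unit_sum_free + cfun.dim (cspace units)"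
    using dim_sum_free_plus_blow_up[OF subspace_unit_sum_free order_refl subspace_cspace order_refl]
    by simp
  then show ?thesis
    using sum_card_units_minus_one by (simp add: dim_cspace finite_V finite_units)
qed

end

text \<open>In the hypergraph on \<open>W\<close> without edges all vertices have the same star, so \<open>W\<close> is its only
  unit and its unit-sum-free functions are the functions on \<open>W\<close> with sum 0.\<close>

lemma dim_zero_sum_space:
  assumes "finite W" "W \<noteq> {}" "W \<subseteq> V"
  shows "cfun.dim (zero_sum_space V W) = card W - 1"
proof -
  interpret edgeless: finite_hypergraph W "{}"
    using assms by unfold_locales (simp add: hypergraph_def)
  have units: "hg_units W {} = {W}"
    using assms(2) by (auto simp: edgeless.units_eq unit_of_def star_def)
  have "zero_sum_space V W = edgeless.unit_sum_free"
    using assms(3) by (auto simp: zero_sum_space_def edgeless.unit_sum_free_def units cspace_def)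
  then show ?thesis
    by (simp add: edgeless.dim_unit_sum_free units)
qed

lemma subspace_zero_sum_space: "cfun.subspace (zero_sum_space V W)"
proof -
  have "zero_sum_space V W = {x. (\<forall>v. v \<notin> V \<or> v \<notin> W \<longrightarrow> x v = 0) \<and> (\<Sum>v\<in>W. x v) = 0}"
    by (auto simp: zero_sum_space_def cspace_def)
  then show ?thesis
    by (auto simp: cfun.subspace_def sum.distrib simp flip: sum_distrib_left)
qed

context finite_hypergraph
begin

lemma zero_sum_space_subset:
  assumes W: "W \<in> units"
  shows "zero_sum_space V W \<subseteq> unit_sum_free"
proof
  fix x assume x: "x \<in> zero_sum_space V W"
  have "(\<Sum>v\<in>U. x v) = 0" if U: "U \<in> units" for U
  proof (cases "U = W")
    case False
    then have "x v = 0" if "v \<in> U" for v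
      using units_disjoint[OF U W] that x by (auto simp: zero_sum_space_def)
    then show ?thesis by simp
  qed (use x in \<open>simp add: zero_sum_space_def\<close>)
  then show "x \<in> unit_sum_free"
    using x by (simp add: unit_sum_free_def zero_sum_space_def)
qed

section \<open>The signless Laplacian factors through functions on units\<close>

text \<open>The value of the signless Laplacian at a vertex depends only on the unit of the vertex;
  as a function of the unit it is the following.\<close>

definition unit_laplacian ::
  "('v set set \<Rightarrow> real) \<Rightarrow> ('v set \<Rightarrow> real) \<Rightarrow> ('v \<Rightarrow> complex) \<Rightarrow> 'v set \<Rightarrow> complex" where
  "unit_laplacian c \<delta>E x = (\<lambda>W. if W \<in> units then
     (\<Sum>e\<in>gen_set V E W. complex_of_real (\<delta>E e / c (gen_set V E W) * (1 / (real (card e))\<^sup>2))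
        * (\<Sum>u\<in>e. x u))
     else 0)"

lemma linear_unit_laplacian: "Vector_Spaces.linear cscale cscale (unit_laplacian c \<delta>E)"
proof -
  have "Vector_Spaces.linear cscale cscale
      (\<lambda>x W. if W \<in> units then \<Sum>e\<in>gen_set V E W. k W e * (\<Sum>u\<in>e. x u) else 0)"
    for k :: "'v set \<Rightarrow> 'v set \<Rightarrow> complex"
    by unfold_locales
      (auto simp: fun_eq_iff sum.distrib distrib_left sum_distrib_left mult.left_commute)
  then show ?thesis
    unfolding unit_laplacian_def .
qed

lemma unit_laplacian_cspace: "unit_laplacian c \<delta>E x \<in> cspace units"
  by (simp add: unit_laplacian_def cspace_def)

lemma unit_laplacian_sum_free:
  assumes "x \<in> unit_sum_free"
  shows "unit_laplacian c \<delta>E x = 0"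
proof -
  have "(\<Sum>u\<in>e. x u) = 0" if "W \<in> units" "e \<in> gen_set V E W" for e W
    using assms that gen_set_subset[of W] by (auto simp: subset_iff sum_edge unit_sum_free_def intro!: sum.neutral)
  then show ?thesis
    by (simp add: unit_laplacian_def fun_eq_iff cong: sum.cong)
qed

lemma signless_laplacian_factors:
  assumes "\<And>v. v \<in> V \<Longrightarrow> \<delta>V v = c (star E v)"
  shows "signless_laplacian V E \<delta>V \<delta>E = blow_up V E \<circ> unit_laplacian c \<delta>E"
proof (intro ext)
  fix x v
  show "signless_laplacian V E \<delta>V \<delta>E x v = (blow_up V E \<circ> unit_laplacian c \<delta>E) x v"
  proof (cases "v \<in> V")
    case True
    then obtain W where "W \<in> units" "v \<in> W" using unit_containing by blast
    then show ?thesis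
      using assms True
      by (simp add: blow_up_on_unit unit_laplacian_def signless_laplacian_def unit_mem(4))
  qed (simp add: signless_laplacian_def blow_up_def)
qed

text \<open>Applied to a blow up, an edge sum collects \<open>card U * y U\<close> from each unit \<open>U\<close> inside the
  edge; exchanging the two sums gives the coefficients of the contraction.\<close>

lemma contraction_factors: "contraction V E c \<delta>E = unit_laplacian c \<delta>E \<circ> blow_up V E"
proof (intro ext)
  fix y W
  show "contraction V E c \<delta>E y W = (unit_laplacian c \<delta>E \<circ> blow_up V E) y W"
  proof (cases "W \<in> units")
    case True
    define G where "G U = gen_set V E U" for U
    define w where "w e = complex_of_real (\<delta>E e / c (G W) * (1 / (real (card e))\<^sup>2))" for e
    have fin: "finite (G W)"
      using gen_set_subset[OF True] finite_E finite_subset by (auto simp: G_def)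
    have edge: "(\<Sum>u\<in>e. blow_up V E y u) = (\<Sum>U\<in>units. if e \<in> G U then of_nat (card U) * y U else 0)"
      if "e \<in> G W" for e
    proof -
      have "e \<in> E" using that gen_set_subset[OF True] by (auto simp: G_def)
      then show ?thesis
        by (simp add: sum_edge G_def sum_blow_up cong: sum.cong if_cong)
    qed
    have "(unit_laplacian c \<delta>E \<circ> blow_up V E) y W = (\<Sum>e\<in>G W. w e * (\<Sum>u\<in>e. blow_up V E y u))"
      using True by (simp add: unit_laplacian_def w_def G_def)
    also have "\<dots> = (\<Sum>e\<in>G W. \<Sum>U\<in>units. w e * (if e \<in> G U then of_nat (card U) * y U else 0))"
      by (intro sum.cong) (simp_all add: edge sum_distrib_left)
    also have "\<dots> = (\<Sum>U\<in>units. \<Sum>e\<in>G W. w e * (if e \<in> G U then of_nat (card U) * y U else 0))"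
      by (rule sum.swap)
    also have "\<dots> = (\<Sum>U\<in>units. (\<Sum>e\<in>G U \<inter> G W. w e) * of_nat (card U) * y U)"
    proof (rule sum.cong[OF refl])
      fix U
      have "(\<Sum>e\<in>G W. w e * (if e \<in> G U then of_nat (card U) * y U else 0))
          = (\<Sum>e\<in>G W. if e \<in> G U then w e * (of_nat (card U) * y U) else 0)"
        by (intro sum.cong) auto
      also have "\<dots> = (\<Sum>e\<in>G U \<inter> G W. w e * (of_nat (card U) * y U))"
        by (subst Int_commute, rule sum.inter_restrict[OF fin, symmetric])
      finally show "(\<Sum>e\<in>G W. w e * (if e \<in> G U then of_nat (card U) * y U else 0))
          = (\<Sum>e\<in>G U \<inter> G W. w e) * of_nat (card U) * y U"
        by (simp add: sum_distrib_right mult.assoc)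
    qed
    also have "\<dots> = contraction V E c \<delta>E y W"
      using True by (simp add: contraction_def w_def G_def)
    finally show ?thesis by simp
  qed (simp add: contraction_def unit_laplacian_def)
qed

section \<open>Eigenspaces\<close>

text \<open>Split an eigenvector into \<open>p\<close> with zero unit sums and the blow up of some \<open>y\<close>. As
  \<open>T\<close> kills \<open>p\<close>, the eigenvector equation says that \<open>\<mu> p\<close> is the blow up of
  \<open>T (blow_up V E y) - \<mu> y\<close>, and both sides vanish because only 0 is a blow up with zero
  unit sums.\<close>

lemma op_eigenspace_decomposition:
  fixes \<mu> :: complex
  assumes T: "Vector_Spaces.linear cscale cscale T" "\<And>x. T x \<in> cspace units"
    and T0: "\<And>x. x \<in> unit_sum_free \<Longrightarrow> T x = 0"
  shows "op_eigenspace V (blow_up V E \<circ> T) \<mu>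
    = {x + y | x y. x \<in> (if \<mu> = 0 then unit_sum_free else {0})
        \<and> y \<in> blow_up V E ` op_eigenspace units (T \<circ> blow_up V E) \<mu>}"
    (is "?L = ?R")
proof (intro equalityI subsetI)
  note B = linear_blow_up
  fix x assume "x \<in> ?L"
  then have x: "x \<in> cspace V" and Tx: "blow_up V E (T x) = cscale \<mu> x"
    by (auto simp: op_eigenspace_def)
  obtain p y where p: "p \<in> unit_sum_free" and y: "y \<in> cspace units" and xpy: "x = p + blow_up V E y"
    using x by (rule unit_mean_decomposition)
  have "T x = T (blow_up V E y)"
    by (simp add: xpy cfun2.linear_add[OF T(1)] T0[OF p])
  then have "cscale \<mu> p = blow_up V E (T (blow_up V E y) - cscale \<mu> y)"
    using Tx by (simp add: xpy cfun2.linear_diff[OF B] cfun2.linear_scale[OF B] cfun.scale_right_distrib)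
  moreover have "cscale \<mu> p \<in> unit_sum_free"
    using p by (simp add: cfun.subspace_scale subspace_unit_sum_free)
  moreover have "T (blow_up V E y) - cscale \<mu> y \<in> cspace units"
    using T(2) y by (intro cfun.subspace_diff cfun.subspace_scale subspace_cspace)
  ultimately have "T (blow_up V E y) - cscale \<mu> y = 0" and "cscale \<mu> p = 0"
    using blow_up_sum_free_trivial cfun2.linear_0[OF B] by metis+
  then have "y \<in> op_eigenspace units (T \<circ> blow_up V E) \<mu>" and "\<mu> \<noteq> 0 \<Longrightarrow> p = 0"
    using y by (auto simp: op_eigenspace_def)
  then show "x \<in> ?R"
    using xpy p by auto
next
  note B = linear_blow_up
  fix z assume "z \<in> ?R"
  then obtain p y where z: "z = p + blow_up V E y" and p: "p \<in> (if \<mu> = 0 then unit_sum_free else {0})"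
    and y: "y \<in> cspace units" "T (blow_up V E y) = cscale \<mu> y"
    by (auto simp: op_eigenspace_def)
  have pfree: "p \<in> unit_sum_free" and \<mu>p: "cscale \<mu> p = 0"
    using p cfun.subspace_0[OF subspace_unit_sum_free] by (auto split: if_splits)
  have "z \<in> cspace V"
    using pfree by (simp add: z unit_sum_free_def cfun.subspace_add[OF subspace_cspace] blow_up_cspace)
  moreover have "blow_up V E (T z) = cscale \<mu> z"
    by (simp add: z cfun2.linear_add[OF T(1)] T0[OF pfree] y(2) cfun2.linear_scale[OF B]
        cfun.scale_right_distrib \<mu>p)
  ultimately show "z \<in> ?L"
    by (simp add: op_eigenspace_def)
qed

end

section \<open>The complete spectrum\<close>

theorem theorem3p5:
  fixes V :: "'v set" and E :: "'v set set"
    and \<delta>V :: "'v \<Rightarrow> real" and \<delta>E :: "'v set \<Rightarrow> real" and c :: "'v set set \<Rightarrow> real"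
  assumes "hypergraph V E"
    and "\<And>v. v \<in> V \<Longrightarrow> \<delta>V v > 0"
    and "\<And>e. e \<in> E \<Longrightarrow> \<delta>E e > 0"
    and "\<And>F v. F \<subseteq> E \<Longrightarrow> unit_of V E F \<in> hg_units V E \<Longrightarrow> v \<in> unit_of V E F \<Longrightarrow> \<delta>V v = c F"
  defines "Q \<equiv> signless_laplacian V E \<delta>V \<delta>E"
    and "Qh \<equiv> contraction V E c \<delta>E"
  shows
    \<comment> \<open>the complete spectrum, with algebraic and with geometric multiplicities\<close>
    "op_spectrum V Q
       = (\<Sum>W\<in>hg_units V E. replicate_mset (card W - 1) 0) + op_spectrum (hg_units V E) Qh
     \<and> (\<forall>\<mu>. cfun.dim (op_eigenspace V Q \<mu>)
         = (if \<mu> = 0 then (\<Sum>W\<in>hg_units V E. card W - 1) else 0)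
           + cfun.dim (op_eigenspace (hg_units V E) Qh \<mu>))
     \<and> (\<forall>W\<in>hg_units V E.
          cfun.subspace (zero_sum_space V W)
          \<and> zero_sum_space V W \<subseteq> op_eigenspace V Q 0
          \<and> cfun.dim (zero_sum_space V W) = card W - 1
          \<and> (card W > 1 \<longrightarrow> op_eigenvalue V Q 0))
     \<and> (\<forall>\<mu> y. op_eigenvector (hg_units V E) Qh y \<mu> \<longrightarrow>
          op_eigenvalue V Q \<mu> \<and> op_eigenvector V Q (blow_up V E y) \<mu>)"
proof -
  interpret finite_hypergraph V E
    by unfold_locales (fact assms(1))
  define T where "T = unit_laplacian c \<delta>E"
  have weight: "\<delta>V v = c (star E v)" if "v \<in> V" for v
    using that by (intro assms(4)) (auto simp: units_eq unit_of_def star_def)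
  have Q: "Q = blow_up V E \<circ> T"
    unfolding Q_def T_def by (rule signless_laplacian_factors) (rule weight)
  have Qh: "Qh = T \<circ> blow_up V E"
    unfolding Qh_def T_def by (rule contraction_factors)
  have T: "Vector_Spaces.linear cscale cscale T" "\<And>x. T x \<in> cspace units"
      "\<And>x. x \<in> unit_sum_free \<Longrightarrow> T x = 0"
    by (simp_all add: T_def linear_unit_laplacian unit_laplacian_cspace unit_laplacian_sum_free)
  have linQh: "Vector_Spaces.linear cscale cscale Qh"
    unfolding Qh by (rule Vector_Spaces.linear_compose[OF linear_blow_up T(1)])
  have eig: "op_eigenspace V Q \<mu> = {x + y | x y. x \<in> (if \<mu> = 0 then unit_sum_free else {0})
      \<and> y \<in> blow_up V E ` op_eigenspace units Qh \<mu>}" for \<mu>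
    unfolding Q Qh using T by (rule op_eigenspace_decomposition)

  have spectrum: "op_spectrum V Q
      = (\<Sum>W\<in>units. replicate_mset (card W - 1) 0) + op_spectrum units Qh"
  proof -
    have "(\<Sum>W\<in>A. replicate_mset (card W - 1) 0) = replicate_mset (\<Sum>W\<in>A. card W - 1) (0 :: complex)"
      for A :: "'v set set"
      by (induction A rule: infinite_finite_induct) (auto simp: replicate_mset_add)
    moreover have "replicate_mset (card units) 0 + op_spectrum V Q
        = replicate_mset (card V) 0 + op_spectrum units Qh"
      unfolding Q Qh using finite_V finite_units linear_blow_up blow_up_cspace T
      by (intro op_spectrum_comp_commute) auto
    ultimately show ?thesis
      by (simp add: replicate_mset_add flip: sum_card_units_minus_one)
  qed

  have dims: "cfun.dim (op_eigenspace V Q \<mu>)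
      = (if \<mu> = 0 then (\<Sum>W\<in>units. card W - 1) else 0) + cfun.dim (op_eigenspace units Qh \<mu>)" for \<mu>
  proof -
    let ?S = "if \<mu> = 0 then unit_sum_free else {0}"
    have "cfun.dim (op_eigenspace V Q \<mu>) = cfun.dim ?S + cfun.dim (op_eigenspace units Qh \<mu>)"
      unfolding eig
    proof (rule dim_sum_free_plus_blow_up)
      show "cfun.subspace ?S"
        using subspace_unit_sum_free by simp
      show "?S \<subseteq> unit_sum_free"
        using cfun.subspace_0[OF subspace_unit_sum_free] by simp
      show "cfun.subspace (op_eigenspace units Qh \<mu>)"
        by (rule subspace_op_eigenspace[OF linQh])
      show "op_eigenspace units Qh \<mu> \<subseteq> cspace units"
        by (auto simp: op_eigenspace_def)
    qed
    moreover have "cfun.dim {0 :: 'v \<Rightarrow> complex} = 0"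
      by (rule cfun.dim_unique[of "{}"]) (auto simp: cfun.independent_empty)
    ultimately show ?thesis
      by (simp add: dim_unit_sum_free)
  qed

  have kernel: "unit_sum_free \<subseteq> op_eigenspace V Q 0"
    using T(3) cfun2.linear_0[OF linear_blow_up] by (auto simp: Q op_eigenspace_def unit_sum_free_def)
  have zero: "op_eigenvalue V Q 0" if W: "W \<in> units" "card W > 1" for W
  proof -
    have "cfun.dim (zero_sum_space V W) > 0"
      using W by (simp add: dim_zero_sum_space finite_unit unit_nonempty unit_subset)
    moreover have "cfun.dim (zero_sum_space V W) \<le> card ({} :: ('v \<Rightarrow> complex) set)" if "zero_sum_space V W \<subseteq> {0}"
      by (rule cfun.dim_le_card) (use that in auto)
    ultimately obtain x where "x \<in> zero_sum_space V W" "x \<noteq> 0"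
      by fastforce
    then show ?thesis
      using zero_sum_space_subset[OF W(1)] kernel
      by (auto simp: op_eigenvalue_def op_eigenvector_def op_eigenspace_def)
  qed

  have blow: "op_eigenvector V Q (blow_up V E y) \<mu>" if y: "op_eigenvector units Qh y \<mu>" for \<mu> y
  proof -
    have "blow_up V E y \<noteq> 0"
      using y blow_up_sum_free_trivial[of y] cfun.subspace_0[OF subspace_unit_sum_free]
      by (auto simp: op_eigenvector_def)
    then show ?thesis
      using y blow_up_cspace by (auto simp: op_eigenvector_def Q Qh cfun2.linear_scale[OF linear_blow_up])
  qed

  have units: "cfun.subspace (zero_sum_space V W) \<and> zero_sum_space V W \<subseteq> op_eigenspace V Q 0
      \<and> cfun.dim (zero_sum_space V W) = card W - 1 \<and> (card W > 1 \<longrightarrow> op_eigenvalue V Q 0)"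
    if W: "W \<in> units" for W
    using subspace_zero_sum_space[of V W] zero_sum_space_subset[OF W] kernel zero[OF W]
      dim_zero_sum_space[OF finite_unit[OF W] unit_nonempty[OF W] unit_subset[OF W]]
    by blast

  have eigenvectors: "op_eigenvalue V Q \<mu> \<and> op_eigenvector V Q (blow_up V E y) \<mu>"
    if "op_eigenvector units Qh y \<mu>" for \<mu> y
    using blow[OF that] by (auto simp: op_eigenvalue_def)

  show ?thesis
    by (intro conjI[OF spectrum] conjI[OF allI[OF dims]] conjI[OF ballI] allI impI units eigenvectors)
qed

end
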